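(* Suppose $\mathbf z_1,\ldots,\mathbf z_6:\mathbb R\to\mathbb C^3$ are differentiable functions satisfying, at $t=0$, $$\omega(\mathbf z_2,\mathbf z_3)=\omega(\mathbf z_1,\mathbf z_3)=\omega(\mathbf z_1,\mathbf z_2)=0,\qquad \omega(\mathbf z_1,\mathbf z_5)+\omega(\mathbf z_2,\mathbf z_5)-\omega(\mathbf z_3,\mathbf z_4)=0,$$ $$-\omega(\mathbf z_1,\mathbf z_4)+\omega(\mathbf z_2,\mathbf z_4)+\omega(\mathbf z_3,\mathbf z_5)=0,\qquad \omega(\mathbf z_4,\mathbf z_5)=0,$$ and, for all $t\in\mathbb R$, $$\frac{d\mathbf z_1}{dt}=2\,\mathbf z_2\times\mathbf z_3,\qquad \frac{d\mathbf z_2}{dt}=2\,\mathbf z_1\times\mathbf z_3,\qquad \frac{d\mathbf z_3}{dt}=-2\,\mathbf z_1\times\mathbf z_2,$$ $$\frac{d\mathbf z_4}{dt}=\mathbf z_1\times\mathbf z_5+\mathbf z_2\times\mathbf z_5-\mathbf z_3\times\mathbf z_4,\qquad \frac{d\mathbf z_5}{dt}=-\mathbf z_1\times\mathbf z_4+\mathbf z_2\times\mathbf z_4+\mathbf z_3\times\mathbf z_5,\qquad \frac{d\mathbf z_6}{dt}=\mathbf z_4\times\mathbf z_5.$$ Define $$N=\bigl\{\tfrac12(y_1^2+y_2^2)\mathbf z_1(t)+\tfrac12(y_1^2-y_2^2)\mathbf z_2(t)+y_1y_2\,\mathbf z_3(t)+y_1\mathbf z_4(t)+y_2\mathbf z_5(t)+\mathbf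 z_6(t):y_1,y_2,t\in\mathbb R\bigr\}.$$ Then $N$ is a special Lagrangian $3$-fold in $\mathbb C^3$ wherever it is nonsingular.
   Context: On $\mathbb C^3$ with complex coordinates $(z_1,z_2,z_3)$ set $g=\sum_j|dz_j|^2$, $\omega=\frac i2\sum_j dz_j\wedge d\bar z_j$ (so $\omega(\mathbf u,\mathbf v)=\operatorname{Im}\sum_j\bar u_jv_j$) and $\Omega=dz_1\wedge dz_2\wedge dz_3$. A special Lagrangian $3$-fold is an oriented real $3$-dimensional submanifold $L$ calibrated by $\operatorname{Re}\Omega$; equivalently, a real $3$-submanifold (with a suitable orientation) on which $\omega|_L\equiv0$ and $\operatorname{Im}\Omega|_L\equiv0$. The cross product $\times:\mathbb C^3\times\mathbb C^3\to\mathbb C^3$ is $(r_1,r_2,r_3)\times(s_1,s_2,s_3)=\frac12(\bar r_2\bar s_3-\bar r_3\bar s_2,\ \bar r_3\bar s_1-\bar r_1\bar s_3,\ \bar r_1\bar s_2-\bar r_2\bar s_1)$. "Wherever it is nonsingular": $N$ is the image of the map $\Phi(y_1,y_2,t)$ given by the displayed vector, and is regarded as an immersed object; the assertion concerns the points where $N$ is a nonsingular (immersed) $3$-submanifold, in particular the restriction of $\Phi$ to the open set where $\Phi$ is an immersion. *)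

theory Defs
  imports "HOL-Analysis.Analysis"
begin

text \<open>Throughout, \<open>\<complex>\<^sup>3\<close> is the type \<open>complex^3\<close> regarded as a real vector space; its library inner
  product is the metric \<open>g = \<Sum>\<^sub>j |dz\<^sub>j|\<^sup>2\<close>.\<close>

definition kahler_form :: "complex^3 \<Rightarrow> complex^3 \<Rightarrow> real" where
  "kahler_form u v = Im (\<Sum>j\<in>UNIV. cnj (u $ j) * v $ j)"

text \<open>\<open>\<Omega> = dz\<^sub>1 \<and> dz\<^sub>2 \<and> dz\<^sub>3\<close>, with the convention \<open>\<Omega>(u\<^sub>1,u\<^sub>2,u\<^sub>3) = det (dz\<^sub>i(u\<^sub>j))\<close>.\<close>

definition hol_volume_form :: "complex^3 \<Rightarrow> complex^3 \<Rightarrow> complex^3 \<Rightarrow> complex" where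
  "hol_volume_form u v w = det (vector [u, v, w] :: complex^3^3)"

definition ccross :: "complex^3 \<Rightarrow> complex^3 \<Rightarrow> complex^3" where
  "ccross r s = vector
     [(cnj (r $ 2) * cnj (s $ 3) - cnj (r $ 3) * cnj (s $ 2)) / 2,
      (cnj (r $ 3) * cnj (s $ 1) - cnj (r $ 1) * cnj (s $ 3)) / 2,
      (cnj (r $ 1) * cnj (s $ 2) - cnj (r $ 2) * cnj (s $ 1)) / 2]"

text \<open>The sets \<open>U\<close> below are meant to be open; in finite dimensions, continuity of the derivative is
  continuity of all directional derivatives.\<close>

primrec Ck_on :: "nat \<Rightarrow> ('a::euclidean_space \<Rightarrow> 'b::real_normed_vector) \<Rightarrow> 'a set \<Rightarrow> bool" where
  "Ck_on 0 f U \<longleftrightarrow> continuous_on U f"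
| "Ck_on (Suc k) f U \<longleftrightarrow> (\<forall>x\<in>U. f differentiable (at x)) \<and>
     (\<forall>v. Ck_on k (\<lambda>x. frechet_derivative f (at x) v) U)"

definition smooth_on :: "('a::euclidean_space \<Rightarrow> 'b::real_normed_vector) \<Rightarrow> 'a set \<Rightarrow> bool" where
  "smooth_on f U \<longleftrightarrow> (\<forall>k. Ck_on k f U)"

definition immersion_on :: "(real^3 \<Rightarrow> complex^3) \<Rightarrow> (real^3) set \<Rightarrow> bool" where
  "immersion_on f U \<longleftrightarrow> open U \<and> smooth_on f U \<and> (\<forall>x\<in>U. inj (frechet_derivative f (at x)))"

definition local_param :: "(complex^3) set \<Rightarrow> (real^3) set \<Rightarrow> (real^3 \<Rightarrow> complex^3) \<Rightarrow> bool" where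
  "local_param M W \<phi> \<longleftrightarrow> immersion_on \<phi> W \<and> openin (top_of_set M) (\<phi> ` W) \<and>
     (\<exists>\<psi>. homeomorphism W (\<phi> ` W) \<phi> \<psi>)"

definition submanifold3 :: "(complex^3) set \<Rightarrow> bool" where
  "submanifold3 M \<longleftrightarrow> (\<forall>p\<in>M. \<exists>W \<phi>. local_param M W \<phi> \<and> p \<in> \<phi> ` W)"

text \<open>A frame of a real 3-plane \<open>V\<close> in \<open>\<complex>\<^sup>3\<close> is encoded as an injective linear map \<open>\<real>\<^sup>3 \<Rightarrow> \<complex>\<^sup>3\<close> with
  image \<open>V\<close>, the frame vectors being the images of the standard basis. For injective linear \<open>D\<close> and
  \<open>s = 1\<close> or \<open>s = -1\<close>, \<open>oriented_frames D s\<close> is one of the two orientations of \<open>range D\<close>: the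
  frames inducing the same (\<open>s = 1\<close>) or the opposite (\<open>s = -1\<close>) orientation as \<open>D\<close>.\<close>

definition oriented_frames :: "(real^3 \<Rightarrow> complex^3) \<Rightarrow> real \<Rightarrow> (real^3 \<Rightarrow> complex^3) set" where
  "oriented_frames D s = {D \<circ> C | C. linear C \<and> sgn (det (matrix C)) = s}"

text \<open>\<open>Re \<Omega>\<close> restricts to the volume form of an oriented 3-plane iff it takes the value 1 on the
  oriented orthonormal frames.\<close>

definition calibrated_frames :: "(real^3 \<Rightarrow> complex^3) set \<Rightarrow> bool" where
  "calibrated_frames F \<longleftrightarrow> (\<forall>A\<in>F.
     (\<forall>i j. A (axis i 1) \<bullet> A (axis j 1) = (if i = j then 1 else 0)) \<longrightarrow>
     Re (hol_volume_form (A (axis 1 1)) (A (axis 2 1)) (A (axis 3 1))) = 1)"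

text \<open>An orientation of a submanifold \<open>M\<close> chooses an orientation of each tangent space, in a way that
  is locally constant with respect to local parametrizations.\<close>

definition orientation_of ::
  "(complex^3) set \<Rightarrow> (complex^3 \<Rightarrow> (real^3 \<Rightarrow> complex^3) set) \<Rightarrow> bool" where
  "orientation_of M ori \<longleftrightarrow> (\<forall>p\<in>M. \<exists>W \<phi> s. local_param M W \<phi> \<and> p \<in> \<phi> ` W \<and> s \<in> {1, -1} \<and>
     (\<forall>x\<in>W. ori (\<phi> x) = oriented_frames (frechet_derivative \<phi> (at x)) s))"

definition special_lagrangian :: "(complex^3) set \<Rightarrow> bool" where
  "special_lagrangian M \<longleftrightarrow> submanifold3 M \<and>
     (\<exists>ori. orientation_of M ori \<and> (\<forall>p\<in>M. calibrated_frames (ori p)))"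

text \<open>The immersed version; here the orientation of the open set \<open>U\<close> of \<open>\<real>\<^sup>3\<close> is given by its sign
  \<open>\<sigma>\<close> relative to the standard orientation.\<close>

definition special_lagrangian_immersion :: "(real^3 \<Rightarrow> complex^3) \<Rightarrow> (real^3) set \<Rightarrow> bool" where
  "special_lagrangian_immersion f U \<longleftrightarrow> immersion_on f U \<and>
     (\<exists>\<sigma>. continuous_on U \<sigma> \<and> \<sigma> ` U \<subseteq> {1, -1} \<and>
       (\<forall>x\<in>U. calibrated_frames (oriented_frames (frechet_derivative f (at x)) (\<sigma> x))))"

end

theory Submission
  imports Defs
begin

text \<open>
  The map in question is \<open>\<Phi>(y\<^sub>1,y\<^sub>2,t)\<close>, quadratic in \<open>y = (y\<^sub>1,y\<^sub>2)\<close>. Write \<open>u = \<partial>\<Phi>/\<partial>y\<^sub>1\<close> and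
  \<open>v = \<partial>\<Phi>/\<partial>y\<^sub>2\<close>. The evolution equations are exactly the coefficients, as polynomials in \<open>y\<close>, of
  the single equation \<open>\<partial>\<Phi>/\<partial>t = u \<times> v\<close> (\<open>ccross_quadratic\<close>). The cross product is built so that
  \<open>u \<times> v\<close> is Hermitian-orthogonal to \<open>u\<close> and \<open>v\<close> and \<open>\<Omega>(u, v, u \<times> v)\<close> is real. Hence the
  differential of \<open>\<Phi>\<close> satisfies both special Lagrangian conditions as soon as \<open>\<omega>(u,v) = 0\<close>.
  For fixed \<open>y\<close> the function \<open>\<omega>(u,v)\<close> is constant in \<open>t\<close>: its derivative is a combination of values
  of the alternating trilinear form \<open>\<omega>(a, b \<times> c)\<close> that cancel because \<open>\<partial>u/\<partial>y\<^sub>2 = \<partial>v/\<partial>y\<^sub>1\<close>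
  (\<open>kahler_form_flow\<close>). At \<open>t = 0\<close> it is a polynomial in \<open>y\<close> whose coefficients vanish by the
  initial conditions (\<open>kahler_form_partials\<close>).

  Passing from these linear conditions to calibrations uses the identity
  \<open>|\<Omega>(u\<^sub>1,u\<^sub>2,u\<^sub>3)|\<^sup>2 = det (g(u\<^sub>i,u\<^sub>j))\<close> on isotropic frames (\<open>det_gram_eq\<close>). If \<open>\<Omega>\<close> is real on the plane,
  it shows that \<open>Re \<Omega>\<close> equals \<open>1\<close> or \<open>-1\<close> on every orthonormal frame, that the sign of \<open>Re \<Omega>\<close> picks
  an orientation, and that \<open>\<Phi>\<close> is an immersion precisely where \<open>Re \<Omega>\<close> is nonzero on its partial
  derivatives, an open condition.

  If an open piece \<open>M\<close> of the image of \<open>\<Phi>\<close> is a submanifold, some points of \<open>M\<close> may be reached only by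
  critical points of \<open>\<Phi>\<close>, so the tangent planes of \<open>M\<close> need not be images of its differential. By
  Sard's theorem, however, such points are rare: the points of \<open>M\<close> that are images of regular points of
  \<open>\<Phi>\<close> are dense (\<open>dense_regular_values\<close>). There the tangent plane of \<open>M\<close> is the image of the differential of
  \<open>\<Phi>\<close> (\<open>local_param_tangent\<close>), and the closed conditions \<open>\<omega> = 0\<close> and \<open>Im \<Omega> = 0\<close> extend to every
  tangent plane by continuity (\<open>special_map_image_tangent\<close>).
\<close>

section \<open>The Kaehler form, the cross product and the holomorphic volume form\<close>

lemma kahler_form_expand:
  "kahler_form u v = Im (cnj (u $ 1) * v $ 1 + cnj (u $ 2) * v $ 2 + cnj (u $ 3) * v $ 3)"
  by (simp add: kahler_form_def sum_3)

lemma ccross_component [simp]: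
  "ccross r s $ 1 = (cnj (r $ 2) * cnj (s $ 3) - cnj (r $ 3) * cnj (s $ 2)) / 2"
  "ccross r s $ 2 = (cnj (r $ 3) * cnj (s $ 1) - cnj (r $ 1) * cnj (s $ 3)) / 2"
  "ccross r s $ 3 = (cnj (r $ 1) * cnj (s $ 2) - cnj (r $ 2) * cnj (s $ 1)) / 2"
  by (simp_all add: ccross_def)

lemma bounded_bilinear_kahler_form: "bounded_bilinear kahler_form"
proof -
  have "bilinear kahler_form"
    by (auto simp: bilinear_def kahler_form_expand algebra_simps intro!: linearI)
  then show ?thesis
    by (simp add: bilinear_conv_bounded_bilinear)
qed

interpretation kahler: bounded_bilinear kahler_form
  by (rule bounded_bilinear_kahler_form)

lemma bounded_bilinear_ccross: "bounded_bilinear ccross"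
proof -
  have "bilinear ccross"
    by (auto simp: bilinear_def vec_eq_iff forall_3 algebra_simps scaleR_conv_of_real[where 'a=complex] add_divide_distrib
        diff_divide_distrib intro!: linearI)
  then show ?thesis
    by (simp add: bilinear_conv_bounded_bilinear)
qed

interpretation ccross: bounded_bilinear ccross
  by (rule bounded_bilinear_ccross)

lemma kahler_form_self [simp]: "kahler_form u u = 0"
  by (simp add: kahler_form_expand)

lemma kahler_form_commute: "kahler_form v u = - kahler_form u v"
  by (simp add: kahler_form_expand algebra_simps)

lemma ccross_self [simp]: "ccross u u = 0"
  by (simp add: vec_eq_iff forall_3 algebra_simps)

text \<open>\<open>\<omega>(a, b \<times> c)\<close> is, up to the factor \<open>-1/2\<close>, the imaginary part of the complex determinant of
  \<open>(a,b,c)\<close>, hence an alternating trilinear form.\<close>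

lemma kahler_form_ccross_cycle: "kahler_form a (ccross b c) = kahler_form b (ccross c a)"
  by (simp add: kahler_form_expand algebra_simps Im_divide_numeral add_divide_distrib diff_divide_distrib)

lemma hol_volume_form_expand:
  "hol_volume_form u v w =
     u $ 1 * v $ 2 * w $ 3 + u $ 2 * v $ 3 * w $ 1 + u $ 3 * v $ 1 * w $ 2
     - u $ 1 * v $ 3 * w $ 2 - u $ 2 * v $ 1 * w $ 3 - u $ 3 * v $ 2 * w $ 1"
  by (simp add: hol_volume_form_def det_3)

lemma kahler_form_ccross_self: "kahler_form u (ccross u v) = 0" "kahler_form v (ccross u v) = 0"
  using kahler_form_ccross_cycle[of u u v] kahler_form_ccross_cycle[of v u v]
    kahler_form_ccross_cycle[of u v u]
  by (simp_all add: kahler.zero_right)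

text \<open>The components of \<open>2 (u \<times> v)\<close> are the conjugates of the \<open>2 \<times> 2\<close> minors of \<open>(u,v)\<close>, so expanding the
  determinant along its last row gives \<open>\<Omega>(u, v, u \<times> v) = 2 |u \<times> v|\<^sup>2\<close>.\<close>

lemma Im_hol_volume_form_ccross: "Im (hol_volume_form u v (ccross u v)) = 0"
  by (simp add: hol_volume_form_expand algebra_simps Im_divide_numeral add_divide_distrib diff_divide_distrib)

text \<open>The metric and the Kaehler form are the real and imaginary parts of one Hermitian form; on an isotropic
  plane that form is therefore real.\<close>

lemma hermitian_product_eq:
  fixes u v :: "complex^3"
  shows "(\<Sum>k\<in>UNIV. cnj (u $ k) * v $ k) = Complex (u \<bullet> v) (kahler_form u v)"
  by (simp add: complex_eq_iff kahler_form_def inner_vec_def inner_complex_def)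

section \<open>Special Lagrangian 3-planes\<close>

definition frame_volume :: "(real^3 \<Rightarrow> complex^3) \<Rightarrow> complex" where
  "frame_volume D = hol_volume_form (D (axis 1 1)) (D (axis 2 1)) (D (axis 3 1))"

definition gram :: "(real^3 \<Rightarrow> complex^3) \<Rightarrow> real^3^3" where
  "gram D = (\<chi> i j. D (axis i 1) \<bullet> D (axis j 1))"

definition isotropic_map :: "(real^3 \<Rightarrow> complex^3) \<Rightarrow> bool" where
  "isotropic_map D \<longleftrightarrow> (\<forall>a b. kahler_form (D a) (D b) = 0)"

lemma linear_real3_expand:
  fixes D :: "real^3 \<Rightarrow> 'b::real_vector"
  assumes "linear D"
  shows "D x = x $ 1 *\<^sub>R D (axis 1 1) + x $ 2 *\<^sub>R D (axis 2 1) + x $ 3 *\<^sub>R D (axis 3 1)"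
proof -
  have "x = x $ 1 *\<^sub>R axis 1 1 + x $ 2 *\<^sub>R axis 2 1 + x $ 3 *\<^sub>R axis 3 1"
    by (simp add: vec_eq_iff forall_3 axis_def)
  then have "D x = D (x $ 1 *\<^sub>R axis 1 1 + x $ 2 *\<^sub>R axis 2 1 + x $ 3 *\<^sub>R axis 3 1)"
    by simp
  then show ?thesis
    by (simp only: linear_add[OF assms] linear_scale[OF assms])
qed

lemma frame_volume_comp:
  assumes "linear D"
  shows "frame_volume (D \<circ> C) = of_real (det (matrix C)) * frame_volume D"
proof -
  note D = linear_real3_expand[OF assms, of "C (axis 1 1)"] linear_real3_expand[OF assms, of "C (axis 2 1)"]
    linear_real3_expand[OF assms, of "C (axis 3 1)"]
  show ?thesis
    unfolding frame_volume_def hol_volume_form_expand det_3 matrix_def o_def D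
    by (simp add: scaleR_conv_of_real[where 'a=complex]) algebra
qed

text \<open>If \<open>A\<close> is the complex matrix with the frame vectors as rows, the entries of \<open>cnj A\<cdot>A\<^sup>T\<close> are the
  Hermitian products of these vectors. On an isotropic plane they are real and form the Gram matrix, so its
  determinant is \<open>cnj (det A) \<cdot> det A\<close>.\<close>

lemma det_gram_eq:
  assumes "isotropic_map D"
  shows "det (gram D) = (cmod (frame_volume D))\<^sup>2"
proof -
  let ?A = "vector [D (axis 1 1), D (axis 2 1), D (axis 3 1)] :: complex^3^3"
  let ?B = "(\<chi> i j. cnj (?A $ i $ j)) :: complex^3^3"
  have row: "?A $ i = D (axis i 1)" for i
    using exhaust_3[of i] by auto
  have "(\<chi> i j. complex_of_real (gram D $ i $ j)) = ?B ** transpose ?A"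
    using hermitian_product_eq[of "D (axis i 1)" "D (axis j 1)" for i j] assms
    by (simp add: vec_eq_iff matrix_matrix_mult_def transpose_def row gram_def
        isotropic_map_def complex_of_real_def)
  then have "det (\<chi> i j. complex_of_real (gram D $ i $ j)) = det (?B) * det ?A"
    by (simp add: det_mul)
  moreover have "det (?B) = cnj (det ?A)"
    by (simp add: det_3)
  moreover have "det (\<chi> i j. complex_of_real (gram D $ i $ j)) = of_real (det (gram D))"
    by (simp add: det_3)
  ultimately have "complex_of_real (det (gram D)) = cnj (frame_volume D) * frame_volume D"
    by (simp add: frame_volume_def hol_volume_form_def)
  also have "\<dots> = of_real ((cmod (frame_volume D))\<^sup>2)"
    by (simp only: complex_norm_square mult.commute)
  finally show ?thesis
    by (simp only: of_real_eq_iff)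
qed

text \<open>The Gram matrix has the same kernel as the map, since \<open>G c = 0\<close> makes \<open>D c\<close> orthogonal to the whole image of \<open>D\<close>,
  itself included. This turns injectivity into an open condition on the frame vectors.\<close>

lemma inj_iff_frame_volume:
  assumes "linear D" "isotropic_map D"
  shows "inj D \<longleftrightarrow> frame_volume D \<noteq> 0"
proof -
  have gram: "(gram D *v c) $ i = D (axis i 1) \<bullet> D c" for c i
    unfolding linear_real3_expand[OF assms(1), of c]
    by (simp add: matrix_vector_mult_def gram_def sum_3 inner_add_right mult.commute)
  have kernel: "gram D *v c = 0 \<longleftrightarrow> D c = 0" for c
  proof
    assume "gram D *v c = 0"
    then have "D (axis i 1) \<bullet> D c = 0" for i
      using gram[of c i] by simp
    then have "D c \<bullet> D c = 0"
      by (subst (1) linear_real3_expand[OF assms(1), of c]) (simp add: inner_add_left)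
    then show "D c = 0" by simp
  next
    assume "D c = 0"
    then have "(gram D *v c) $ i = 0 $ i" for i
      by (simp only: gram inner_zero_right zero_index)
    then show "gram D *v c = 0" by (simp only: vec_eq_iff) simp
  qed
  have "frame_volume D \<noteq> 0 \<longleftrightarrow> invertible (gram D)"
    by (simp add: invertible_det_nz det_gram_eq[OF assms(2)])
  also have "\<dots> \<longleftrightarrow> (\<forall>c. gram D *v c = 0 \<longrightarrow> c = 0)"
    by (simp add: invertible_left_inverse matrix_left_invertible_ker)
  also have "\<dots> \<longleftrightarrow> inj D"
    by (simp add: kernel linear_injective_0[OF assms(1)])
  finally show ?thesis ..
qed

lemma orthonormal_frame_volume:
  assumes "isotropic_map A" "\<And>i j. A (axis i 1) \<bullet> A (axis j 1) = (if i = j then 1 else 0)"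
  shows "cmod (frame_volume A) = 1"
proof -
  have "gram A = mat 1"
    by (simp add: gram_def mat_def assms(2))
  then have "(cmod (frame_volume A))\<^sup>2 = 1"
    using det_gram_eq[OF assms(1)] by simp
  then show ?thesis
    by (simp add: power2_eq_1_iff) (use norm_ge_zero[of "frame_volume A"] in linarith)
qed

text \<open>For injective maps this says that the image, suitably oriented, is a special Lagrangian plane.
  Leaving out injectivity gives a closed condition, which passes to limits and also holds at the
  critical points of the parametrization.\<close>

definition special_map :: "(real^3 \<Rightarrow> complex^3) \<Rightarrow> bool" where
  "special_map D \<longleftrightarrow> linear D \<and> isotropic_map D \<and> Im (frame_volume D) = 0"

lemma factor_through_injective:
  fixes D A :: "real^3 \<Rightarrow> complex^3"
  assumes "linear D" "inj D" "linear A" "range A \<subseteq> range D"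
  obtains C where "linear C" "A = D \<circ> C"
proof -
  obtain L where L: "linear L" "L \<circ> D = id"
    using linear_injective_left_inverse[OF assms(1,2)] by blast
  have "linear (L \<circ> A)"
    using L(1) assms(3) by (rule linear_compose[rotated])
  moreover have "A = D \<circ> (L \<circ> A)"
  proof
    fix x
    obtain y where "A x = D y" using assms(4) by blast
    with L(2) show "A x = (D \<circ> (L \<circ> A)) x"
      by (simp add: pointfree_idE)
  qed
  ultimately show ?thesis by (rule that)
qed

lemma special_map_subspace:
  assumes "special_map D" "inj D" "linear A" "range A \<subseteq> range D"
  shows "special_map A"
proof -
  have D: "linear D" using assms(1) by (simp add: special_map_def)
  obtain C where C: "linear C" "A = D \<circ> C"
    using factor_through_injective[OF D assms(2-4)] .
  then show ?thesis
    using assms(1,3) by (auto simp: special_map_def isotropic_map_def frame_volume_comp[OF D])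
qed

text \<open>Since \<open>\<Omega>\<close> is real on the plane, it scales by the real factor \<open>det C\<close> under a change of frame \<open>C\<close>;
  so the sign of \<open>Re \<Omega>\<close> separates the two orientations. The right-hand side depends on \<open>D\<close> only through
  its image, so it does not change with the parametrization.\<close>

lemma oriented_frames_eq:
  assumes "special_map D" "inj D" "s = sgn (Re (frame_volume D))"
  shows "oriented_frames D s = {A. linear A \<and> range A \<subseteq> range D \<and> Re (frame_volume A) > 0}"
proof -
  have D: "linear D" "isotropic_map D" "Im (frame_volume D) = 0"
    using assms(1) by (auto simp: special_map_def)
  have nz: "Re (frame_volume D) \<noteq> 0"
    using inj_iff_frame_volume[OF D(1,2)] assms(2) D(3) by (auto simp: complex_eq_iff)
  have *: "sgn (det (matrix C)) = s \<longleftrightarrow> Re (frame_volume (D \<circ> C)) > 0" for C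
    using nz by (auto simp: frame_volume_comp[OF D(1)] assms(3) sgn_if zero_less_mult_iff)
  show ?thesis
  proof safe
    fix A assume "A \<in> oriented_frames D s"
    then obtain C where C: "A = D \<circ> C" "linear C" "sgn (det (matrix C)) = s"
      by (auto simp: oriented_frames_def)
    then show "linear A" "Re (frame_volume A) > 0"
      using * D(1) by (auto simp: linear_compose)
    fix x show "A x \<in> range D" using C by simp
  next
    fix A assume A: "linear A" "range A \<subseteq> range D" "0 < Re (frame_volume A)"
    obtain C where "linear C" "A = D \<circ> C"
      using factor_through_injective[OF D(1) assms(2) A(1,2)] .
    then show "A \<in> oriented_frames D s"
      using A(3) * by (auto simp: oriented_frames_def)
  qed
qed

lemma calibrated_framesI:
  assumes "\<And>A. A \<in> F \<Longrightarrow> special_map A \<and> Re (frame_volume A) > 0"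
  shows "calibrated_frames F"
  unfolding calibrated_frames_def frame_volume_def[symmetric]
proof (intro ballI impI)
  fix A assume "A \<in> F"
    and on: "\<forall>i j. A (axis i 1) \<bullet> A (axis j 1) = (if i = j then 1 else 0)"
  then have A: "isotropic_map A" "Im (frame_volume A) = 0" "Re (frame_volume A) > 0"
    using assms by (auto simp: special_map_def)
  have "cmod (frame_volume A) = 1"
    using orthonormal_frame_volume[OF A(1)] on by blast
  with A show "Re (frame_volume A) = 1"
    by (simp add: cmod_def)
qed

lemma calibrated_oriented_frames:
  assumes "special_map D" "inj D"
  shows "calibrated_frames (oriented_frames D (sgn (Re (frame_volume D))))"
  using special_map_subspace[OF assms]
  by (intro calibrated_framesI) (auto simp: oriented_frames_eq[OF assms refl])

section \<open>Smooth maps and their tangent planes\<close>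

lemma Ck_on_subset: "Ck_on k f U \<Longrightarrow> V \<subseteq> U \<Longrightarrow> Ck_on k f V"
  by (induction k arbitrary: f) (auto intro: continuous_on_subset)

lemma smooth_on_subset: "smooth_on f U \<Longrightarrow> V \<subseteq> U \<Longrightarrow> smooth_on f V"
  by (auto simp: smooth_on_def intro: Ck_on_subset)

lemma smooth_on_has_derivative:
  assumes "smooth_on f U" "x \<in> U"
  shows "(f has_derivative frechet_derivative f (at x)) (at x)"
proof -
  have "Ck_on (Suc 0) f U" using assms(1) by (simp only: smooth_on_def)
  then show ?thesis using assms(2) by (simp add: frechet_derivative_works)
qed

lemma smooth_on_continuous_derivative:
  assumes "smooth_on f U"
  shows "continuous_on U (\<lambda>x. frechet_derivative f (at x) v)"
proof -
  have "Ck_on (Suc 0) f U" using assms(1) by (simp only: smooth_on_def)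
  then show ?thesis by simp
qed

lemma smooth_on_continuous: "smooth_on f U \<Longrightarrow> continuous_on U f"
  by (metis Ck_on.simps(1) smooth_on_def)

lemma smooth_on_continuous_frame_volume:
  assumes "smooth_on f U"
  shows "continuous_on U (\<lambda>x. frame_volume (frechet_derivative f (at x)))"
  unfolding frame_volume_def hol_volume_form_expand
  by (intro continuous_intros smooth_on_continuous_derivative assms)

text \<open>Tangent vectors of \<open>f = \<phi> \<circ> \<gamma>\<close> are tangent to the image of the immersion \<open>\<phi>\<close> even though \<open>\<gamma>\<close> is only known to be
  continuous. With a left inverse \<open>L\<close> of the differential \<open>D\<close> of \<open>\<phi>\<close>, the component \<open>L \<circ> \<phi>\<close> controls the
  displacement of \<open>\<gamma>\<close> by that of \<open>f\<close>, so \<open>\<gamma>\<close> is Lipschitz at the point. The transversal component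
  \<open>Q = id - D \<circ> L\<close> of \<open>\<phi>\<close> has derivative zero, hence so does that of \<open>f\<close>.\<close>

lemma derivative_range_subset:
  fixes \<phi> :: "'a::euclidean_space \<Rightarrow> 'b::euclidean_space"
    and f :: "'c::real_normed_vector \<Rightarrow> 'b" and \<gamma> :: "'c \<Rightarrow> 'a"
  assumes \<phi>: "(\<phi> has_derivative D) (at (\<gamma> x))" and inj: "inj D"
    and f: "(f has_derivative A) (at x)"
    and cont: "isCont \<gamma> x"
    and eq: "\<forall>\<^sub>F y in nhds x. \<phi> (\<gamma> y) = f y"
  shows "range A \<subseteq> range D"
proof -
  have linD: "bounded_linear D" using \<phi> by (rule has_derivative_bounded_linear)
  obtain L where "linear L" and L: "L \<circ> D = id"
    using linear_injective_left_inverse[OF bounded_linear.linear[OF linD] inj] by blast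
  then have linL: "bounded_linear L" by (simp add: linear_conv_bounded_linear)
  have LD: "L (D v) = v" for v using L by (simp add: pointfree_idE)
  define Q where "Q v = v - D (L v)" for v
  have linQ: "bounded_linear Q"
    unfolding Q_def
    by (intro bounded_linear_sub bounded_linear_ident bounded_linear_compose[OF linD linL])
  have L\<phi>: "((\<lambda>w. L (\<phi> w)) has_derivative (\<lambda>h. h)) (at (\<gamma> x))"
    using bounded_linear.has_derivative[OF linL \<phi>] by (simp add: LD)
  have Q\<phi>: "((\<lambda>w. Q (\<phi> w)) has_derivative (\<lambda>h. 0)) (at (\<gamma> x))"
    using bounded_linear.has_derivative[OF linQ \<phi>] by (simp add: Q_def LD)
  have Lf: "((\<lambda>y. L (f y)) has_derivative (\<lambda>h. L (A h))) (at x)"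
    using bounded_linear.has_derivative[OF linL f] .
  obtain K where K: "K > 0" "\<And>h. norm (L (A h)) \<le> norm h * K"
    using bounded_linear.pos_bounded[OF has_derivative_bounded_linear[OF Lf]] by blast
  have fx: "f x = \<phi> (\<gamma> x)"
    using eventually_nhds_x_imp_x[OF eq] by simp
  have tend: "filterlim \<gamma> (nhds (\<gamma> x)) (nhds x)"
    using cont by (simp add: isCont_def tendsto_at_iff_tendsto_nhds)
  have "((\<lambda>y. Q (f y)) has_derivative (\<lambda>h. 0)) (at x)"
    unfolding has_derivative_at_alt
  proof (intro conjI allI impI bounded_linear_zero)
    fix e :: real assume e: "e > 0"
    \<comment> \<open>the displacement of \<open>\<gamma>\<close> is at most \<open>2 (K + 1)\<close> times that of the argument\<close>
    define e' where "e' = e / (2 * (K + 1))"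
    have e': "e' > 0" using e K(1) by (simp add: e'_def)
    have near: "\<forall>\<^sub>F w in nhds a. norm (g w - g a - g' (w - a)) \<le> \<epsilon> * norm (w - a)"
      if "(g has_derivative g') (at a)" "\<epsilon> > 0"
      for a \<epsilon> and g :: "'d::real_normed_vector \<Rightarrow> 'e::real_normed_vector" and g'
      using that unfolding has_derivative_at_alt eventually_nhds_metric dist_norm by blast
    have "\<forall>\<^sub>F y in nhds x. norm (Q (f y) - Q (f x) - 0) \<le> e * norm (y - x)"
      using eq filterlim_iff[THEN iffD1, OF tend, rule_format, OF near[OF L\<phi>, of "1/2", simplified]]
        filterlim_iff[THEN iffD1, OF tend, rule_format, OF near[OF Q\<phi> e']]
        near[OF Lf zero_less_one]
    proof eventually_elim
      case (elim y)
      have "norm (\<gamma> y - \<gamma> x) \<le> 2 * norm (L (f y) - L (f x))"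
      proof -
        have "norm (\<gamma> y - \<gamma> x) \<le> norm (L (f y) - L (f x)) + norm (L (f y) - L (f x) - (\<gamma> y - \<gamma> x))"
          using norm_triangle_sub[of "\<gamma> y - \<gamma> x" "L (f y) - L (f x)"] by (simp add: norm_minus_commute)
        then show ?thesis using elim(1,2) fx by simp
      qed
      also have "norm (L (f y) - L (f x)) \<le> (K + 1) * norm (y - x)"
      proof -
        have "norm (L (f y) - L (f x))
            \<le> norm (L (A (y - x))) + norm (L (f y) - L (f x) - L (A (y - x)))"
          by (rule norm_triangle_sub)
        also have "\<dots> \<le> norm (y - x) * K + 1 * norm (y - x)"
          using K(2) elim(4) by (rule add_mono)
        finally show ?thesis by (simp add: algebra_simps)
      qed
      finally have g: "norm (\<gamma> y - \<gamma> x) \<le> 2 * (K + 1) * norm (y - x)"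
        by (simp only: mult.assoc)
      have "norm (Q (f y) - Q (f x) - 0) \<le> e' * norm (\<gamma> y - \<gamma> x)"
        using elim(1,3) fx by simp
      also have "\<dots> \<le> e' * (2 * (K + 1) * norm (y - x))"
        using g e' by simp
      also have "\<dots> = e * norm (y - x)"
        using K(1) by (simp add: e'_def)
      finally show ?case .
    qed
    then show "\<exists>d>0. \<forall>y. norm (y - x) < d \<longrightarrow> norm (Q (f y) - Q (f x) - 0) \<le> e * norm (y - x)"
      unfolding eventually_nhds_metric dist_norm by blast
  qed
  moreover have "((\<lambda>y. Q (f y)) has_derivative (\<lambda>h. Q (A h))) (at x)"
    using bounded_linear.has_derivative[OF linQ f] .
  ultimately have "(\<lambda>h. 0) = (\<lambda>h. Q (A h))"
    by (rule has_derivative_unique)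
  then have "A h = D (L (A h))" for h
    by (metis Q_def eq_iff_diff_eq_0)
  then show ?thesis by blast
qed

text \<open>The inverse of a chart is continuous, so any differentiable map into the submanifold factors
  locally through the chart by a continuous map.\<close>

lemma local_param_tangent:
  assumes M: "local_param M W \<phi>" and w: "w \<in> W"
    and f: "(f has_derivative A) (at x)" "open V" "x \<in> V" "continuous_on V f" "f ` V \<subseteq> M"
    and fx: "f x = \<phi> w"
  shows "range A \<subseteq> range (frechet_derivative \<phi> (at w))"
proof -
  have im: "immersion_on \<phi> W" and op: "openin (top_of_set M) (\<phi> ` W)"
    using M by (auto simp: local_param_def)
  obtain \<psi> where \<psi>: "homeomorphism W (\<phi> ` W) \<phi> \<psi>" using M by (auto simp: local_param_def)
  obtain T where T: "open T" "\<phi> ` W = M \<inter> T" using op by (auto simp: openin_open)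
  define V' where "V' = V \<inter> f -` T"
  have V': "open V'" "x \<in> V'" "f ` V' \<subseteq> \<phi> ` W"
    using f T fx w by (auto simp: V'_def intro: continuous_open_preimage)
  have "continuous_on V' (\<psi> \<circ> f)"
    using f(4) V'(3) \<psi> by (intro continuous_on_compose)
      (auto simp: V'_def homeomorphism_def intro: continuous_on_subset)
  then have cont: "isCont (\<psi> \<circ> f) x"
    using V' continuous_on_eq_continuous_at by blast
  have \<gamma>x: "(\<psi> \<circ> f) x = w" using \<psi> w fx by (simp add: homeomorphism_def)
  have "\<phi> ((\<psi> \<circ> f) y) = f y" if "y \<in> V'" for y
    using homeomorphism_apply2[OF \<psi>, of "f y"] V'(3) that by auto
  then have "\<forall>\<^sub>F y in nhds x. \<phi> ((\<psi> \<circ> f) y) = f y"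
    using V' unfolding eventually_nhds by blast
  moreover have "(\<phi> has_derivative frechet_derivative \<phi> (at w)) (at ((\<psi> \<circ> f) x))"
    "inj (frechet_derivative \<phi> (at w))"
    using im w unfolding \<gamma>x immersion_on_def by (auto intro: smooth_on_has_derivative)
  ultimately show ?thesis
    using f(1) cont by (intro derivative_range_subset[where \<gamma> = "\<psi> \<circ> f"])
qed

lemma range_eq_if_injective:
  fixes A D :: "real^3 \<Rightarrow> complex^3"
  assumes "linear A" "inj A" "linear D" "inj D" "range A \<subseteq> range D"
  shows "range A = range D"
proof (rule subspace_dim_equal)
  show "subspace (range A)" "subspace (range D)"
    using assms by (auto intro: linear_subspace_image)
  have "dim (range A) = dim (UNIV :: (real^3) set)" "dim (range D) = dim (UNIV :: (real^3) set)"
    using assms by (simp_all only: dim_image_eq span_UNIV)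
  then show "dim (range D) \<le> dim (range A)" by simp
qed (rule assms)

section \<open>Images of maps with special Lagrangian differential\<close>

text \<open>Composing with a left inverse \<open>L\<close> of the differential of \<open>\<phi>\<close> at \<open>w\<close> brings everything into \<open>\<real>\<^sup>3\<close>. There Sard's
  theorem makes the image under \<open>L \<circ> \<Phi>\<close> of the critical points of \<open>\<Phi>\<close> negligible, while \<open>L \<circ> \<phi>\<close>, whose differential at
  \<open>w\<close> is the identity, maps every neighbourhood of \<open>w\<close> onto a set with interior.\<close>

lemma dense_regular_values:
  fixes \<phi> \<Phi> :: "real^3 \<Rightarrow> complex^3"
  assumes \<phi>: "immersion_on \<phi> W" and sub: "\<phi> ` W \<subseteq> range \<Phi>"
    and \<Phi>: "\<And>x. (\<Phi> has_derivative \<Phi>' x) (at x)"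
    and B: "open B" "B \<subseteq> W" "w \<in> B"
  shows "\<exists>v\<in>B. \<exists>x. \<phi> v = \<Phi> x \<and> inj (\<Phi>' x)"
proof -
  let ?D = "frechet_derivative \<phi> (at w)"
  have der: "(\<phi> has_derivative ?D) (at w)" and inj: "inj ?D"
    using \<phi> B by (auto simp: immersion_on_def intro: smooth_on_has_derivative)
  obtain L where "linear L" and L: "L \<circ> ?D = id"
    using linear_injective_left_inverse[OF has_derivative_linear[OF der] inj] by blast
  then have linL: "bounded_linear L" by (simp add: linear_conv_bounded_linear)
  have LD: "L (?D v) = v" for v using L by (simp add: pointfree_idE)
  let ?C = "{x. \<not> inj (\<Phi>' x)}"
  have "negligible ((\<lambda>x. L (\<Phi> x)) ` ?C)"
  proof (rule baby_Sard[where f' = "\<lambda>x h. L (\<Phi>' x h)"])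
    fix x assume x: "x \<in> ?C"
    have d: "((\<lambda>x. L (\<Phi> x)) has_derivative (\<lambda>h. L (\<Phi>' x h))) (at x)"
      using bounded_linear.has_derivative[OF linL \<Phi>] .
    then show "((\<lambda>x. L (\<Phi> x)) has_derivative (\<lambda>h. L (\<Phi>' x h))) (at x within ?C)"
      by (rule has_derivative_at_withinI)
    let ?m = "matrix (\<lambda>h. L (\<Phi>' x h))"
    have "(*v) ?m = (\<lambda>h. L (\<Phi>' x h))"
      using has_derivative_linear[OF d] by (simp add: fun_eq_iff matrix_works)
    moreover have "\<not> inj (\<lambda>h. L (\<Phi>' x h))"
      using x by (auto simp: inj_def) metis
    ultimately have "rank ?m \<noteq> CARD(3)" by (simp only: full_rank_injective not_False_eq_True)
    then show "rank ?m < CARD(3)" using rank_bound[of ?m] by simp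
  qed simp
  moreover have "L (\<phi> w) \<in> interior ((\<lambda>v. L (\<phi> v)) ` B)"
  proof (rule sussmann_open_mapping[OF B(1)])
    show "continuous_on B (\<lambda>v. L (\<phi> v))"
      using \<phi> B(2) by (intro bounded_linear.continuous_on[OF linL])
        (auto simp: immersion_on_def intro: continuous_on_subset smooth_on_continuous)
    show "((\<lambda>v. L (\<phi> v)) has_derivative (\<lambda>h. L (?D h))) (at w)"
      using bounded_linear.has_derivative[OF linL der] .
    show "(\<lambda>h. L (?D h)) \<circ> id = id" by (simp add: fun_eq_iff LD)
  qed (use B in \<open>auto simp: interior_open id_def\<close>)
  ultimately have "\<not> (\<lambda>v. L (\<phi> v)) ` B \<subseteq> (\<lambda>x. L (\<Phi> x)) ` ?C"
    using negligible_subset open_not_negligible interior_subset open_interior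
    by (metis empty_iff)
  then obtain v where v: "v \<in> B" "L (\<phi> v) \<notin> (\<lambda>x. L (\<Phi> x)) ` ?C" by blast
  obtain x where "\<phi> v = \<Phi> x" using v(1) B(2) sub by blast
  with v show ?thesis by force
qed

text \<open>The orientation for which \<open>Re \<Omega>\<close> is positive on oriented frames. Quantifying over all charts at \<open>p\<close> avoids choosing
  one; all of them give the same tangent plane.\<close>

definition tangent_orientation :: "(complex^3) set \<Rightarrow> complex^3 \<Rightarrow> (real^3 \<Rightarrow> complex^3) set" where
  "tangent_orientation M p = {A. linear A \<and> Re (frame_volume A) > 0 \<and>
     (\<exists>W \<phi> w. local_param M W \<phi> \<and> w \<in> W \<and> \<phi> w = p \<and> range A \<subseteq> range (frechet_derivative \<phi> (at w)))}"

lemma local_param_tangent_unique: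
  assumes "local_param M W \<phi>" "w \<in> W" "local_param M W' \<phi>'" "w' \<in> W'" "\<phi>' w' = \<phi> w"
  shows "range (frechet_derivative \<phi>' (at w')) \<subseteq> range (frechet_derivative \<phi> (at w))"
proof (rule local_param_tangent[OF assms(1,2), where x = w' and V = W' and f = \<phi>'])
  have im: "immersion_on \<phi>' W'" using assms(3) by (simp add: local_param_def)
  then show "(\<phi>' has_derivative frechet_derivative \<phi>' (at w')) (at w')" "open W'" "continuous_on W' \<phi>'"
    using assms(4) by (auto simp: immersion_on_def intro: smooth_on_has_derivative smooth_on_continuous)
  show "\<phi>' ` W' \<subseteq> M" using assms(3) by (auto simp: local_param_def dest: openin_imp_subset)
qed (use assms in auto)

lemma tangent_orientation_eq:
  assumes M: "local_param M W \<phi>" "w \<in> W" and sp: "special_map (frechet_derivative \<phi> (at w))"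
  shows "tangent_orientation M (\<phi> w) =
    oriented_frames (frechet_derivative \<phi> (at w)) (sgn (Re (frame_volume (frechet_derivative \<phi> (at w)))))"
proof -
  have inj: "inj (frechet_derivative \<phi> (at w))"
    using M by (auto simp: local_param_def immersion_on_def)
  show ?thesis
    unfolding oriented_frames_eq[OF sp inj refl] tangent_orientation_def
    using M local_param_tangent_unique[OF M] by blast
qed

lemma local_param_restrict:
  assumes M: "local_param M W \<phi>" and W': "open W'" "W' \<subseteq> W"
  shows "local_param M W' \<phi>"
proof -
  obtain \<psi> where \<psi>: "homeomorphism W (\<phi> ` W) \<phi> \<psi>" using M by (auto simp: local_param_def)
  have "openin (top_of_set (\<phi> ` W)) (\<phi> ` W')"
    using W' by (intro homeomorphism_imp_open_map[OF \<psi>]) (auto intro: open_subset)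
  then have "openin (top_of_set M) (\<phi> ` W')"
    using M openin_trans by (auto simp: local_param_def)
  moreover have "homeomorphism W' (\<phi> ` W') \<phi> \<psi>"
    using W'(2) by (intro homeomorphism_of_subsets[OF \<psi> _ order_refl]) auto
  moreover have "immersion_on \<phi> W'"
    using M W' by (auto simp: local_param_def immersion_on_def intro: smooth_on_subset)
  ultimately show ?thesis by (auto simp: local_param_def)
qed

lemma special_lagrangianI:
  assumes M: "submanifold3 M"
    and sp: "\<And>W \<phi> w. local_param M W \<phi> \<Longrightarrow> w \<in> W \<Longrightarrow> special_map (frechet_derivative \<phi> (at w))"
  shows "special_lagrangian M"
  unfolding special_lagrangian_def
proof (intro conjI exI ballI)
  show "submanifold3 M" by fact
  show "calibrated_frames (tangent_orientation M p)" if "p \<in> M" for p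
  proof -
    obtain W \<phi> w where c: "local_param M W \<phi>" "w \<in> W" "p = \<phi> w"
      using M \<open>p \<in> M\<close> by (auto simp: submanifold3_def)
    have "inj (frechet_derivative \<phi> (at w))"
      using c by (auto simp: local_param_def immersion_on_def)
    then show ?thesis
      using calibrated_oriented_frames[OF sp[OF c(1,2)]]
      by (simp only: c(3) tangent_orientation_eq[OF c(1,2) sp[OF c(1,2)]])
  qed
  show "orientation_of M (tangent_orientation M)"
    unfolding orientation_of_def
  proof
    fix p assume "p \<in> M"
    then obtain W \<phi> w where c: "local_param M W \<phi>" "w \<in> W" "p = \<phi> w"
      using M by (auto simp: submanifold3_def)
    define v where "v x = Re (frame_volume (frechet_derivative \<phi> (at x)))" for x
    have im: "immersion_on \<phi> W" using c(1) by (simp add: local_param_def)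
    have "continuous_on W v"
      unfolding v_def using im
      by (auto simp: immersion_on_def intro!: continuous_intros smooth_on_continuous_frame_volume)
    \<comment> \<open>an orientation must be a constant sign relative to a chart, so the chart is shrunk to where \<open>Re \<Omega>\<close> keeps its sign\<close>
    define W' where "W' = {x \<in> W. v w * v x > 0}"
    have "W' = W \<inter> (\<lambda>x. v w * v x) -` {0<..}" by (auto simp: W'_def)
    then have op: "open W'"
      using im \<open>continuous_on W v\<close>
      by (auto simp: immersion_on_def intro!: continuous_open_preimage continuous_intros)
    have nz: "v w \<noteq> 0"
      using sp[OF c(1,2)] im c(2) inj_iff_frame_volume[of "frechet_derivative \<phi> (at w)"]
      by (auto simp: special_map_def immersion_on_def v_def complex_eq_iff)
    have lp: "local_param M W' \<phi>"
      by (rule local_param_restrict[OF c(1) op]) (auto simp: W'_def)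
    have "w \<in> W'" using nz c(2) by (auto simp: W'_def zero_less_mult_iff)
    have sgn: "sgn (v x) = sgn (v w)" if "x \<in> W'" for x
      using that by (auto simp: W'_def sgn_if zero_less_mult_iff)
    have "tangent_orientation M (\<phi> x) = oriented_frames (frechet_derivative \<phi> (at x)) (sgn (v w))"
      if "x \<in> W'" for x
      using tangent_orientation_eq[OF lp that sp[OF lp that]] sgn[OF that] by (simp add: v_def)
    moreover have "sgn (v w) \<in> {1, -1}" using nz by (auto simp: sgn_if)
    ultimately show "\<exists>W \<phi> s. local_param M W \<phi> \<and> p \<in> \<phi> ` W \<and> s \<in> {1, -1} \<and>
     (\<forall>x\<in>W. tangent_orientation M (\<phi> x) = oriented_frames (frechet_derivative \<phi> (at x)) s)"
      using lp \<open>w \<in> W'\<close> c(3) by blast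
  qed
qed

text \<open>At images of regular points of \<open>\<Phi>\<close> the tangent plane is an image of \<open>\<Phi>'\<close>. These points are dense and
  the special Lagrangian equations are continuous along a chart, so they hold at all points.\<close>

lemma special_map_image_tangent:
  fixes \<Phi> :: "real^3 \<Rightarrow> complex^3"
  assumes \<Phi>: "\<And>x. (\<Phi> has_derivative \<Phi>' x) (at x)"
    and sp: "\<And>x. special_map (\<Phi>' x)"
    and U: "open U" and M: "local_param (range \<Phi> \<inter> U) W \<phi>" "w \<in> W"
  shows "special_map (frechet_derivative \<phi> (at w))"
proof -
  let ?D = "\<lambda>w. frechet_derivative \<phi> (at w)"
  have im: "immersion_on \<phi> W" and sub: "\<phi> ` W \<subseteq> range \<Phi> \<inter> U"
    using M(1) by (auto simp: local_param_def dest: openin_imp_subset)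
  have smooth: "smooth_on \<phi> W" and opW: "open W" using im by (auto simp: immersion_on_def)
  have lin: "linear (?D v)" and inj: "inj (?D v)" if "v \<in> W" for v
    using im that by (auto simp: immersion_on_def intro: has_derivative_linear smooth_on_has_derivative)
  have contN: "continuous_on X \<Phi>" for X
    using \<Phi> by (meson has_derivative_at_withinI has_derivative_continuous_on)
  have reg: "special_map (?D v)" if v: "v \<in> W" "\<phi> v = \<Phi> x" "inj (\<Phi>' x)" for v x
  proof -
    have "range (\<Phi>' x) \<subseteq> range (?D v)"
    proof (rule local_param_tangent[OF M(1) v(1) \<Phi>])
      show "open (\<Phi> -` U)" using U contN by (simp add: open_vimage)
      show "x \<in> \<Phi> -` U" using v sub by auto
    qed (use contN v in auto)
    then have "range (\<Phi>' x) = range (?D v)"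
      using v(3) lin[OF v(1)] inj[OF v(1)] has_derivative_linear[OF \<Phi>]
      by (intro range_eq_if_injective) auto
    then show ?thesis
      using special_map_subspace[OF sp v(3) lin[OF v(1)]] by simp
  qed
  have zero: "g w = 0" if "continuous_on W g" "\<And>v. special_map (?D v) \<Longrightarrow> g v = 0" for g :: "real^3 \<Rightarrow> real"
  proof (rule ccontr)
    assume "g w \<noteq> 0"
    let ?B = "W \<inter> g -` (- {0})"
    have "open ?B" using that(1) opW by (intro continuous_open_preimage) auto
    moreover have "w \<in> ?B" using M(2) \<open>g w \<noteq> 0\<close> by simp
    ultimately obtain v x where "v \<in> ?B" "\<phi> v = \<Phi> x" "inj (\<Phi>' x)"
      using dense_regular_values[OF im _ \<Phi>, of ?B w] sub by blast
    then show False using reg that(2) by auto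
  qed
  have "kahler_form (?D w a) (?D w b) = 0" for a b
    by (rule zero) (auto simp: special_map_def isotropic_map_def
      intro!: kahler.continuous_on smooth_on_continuous_derivative smooth)
  moreover have "Im (frame_volume (?D w)) = 0"
    by (rule zero) (auto simp: special_map_def
      intro!: continuous_intros smooth_on_continuous_frame_volume smooth)
  ultimately show ?thesis
    using lin[OF M(2)] by (simp add: special_map_def isotropic_map_def)
qed

lemma special_lagrangian_immersionI:
  fixes \<Phi> :: "real^3 \<Rightarrow> complex^3"
  assumes smooth: "smooth_on \<Phi> UNIV"
    and sp: "\<And>x. special_map (frechet_derivative \<Phi> (at x))"
  shows "special_lagrangian_immersion \<Phi> {x. inj (frechet_derivative \<Phi> (at x))}"
proof -
  define v where "v x = Re (frame_volume (frechet_derivative \<Phi> (at x)))" for x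
  have cont: "continuous_on X v" for X
    unfolding v_def using smooth_on_subset[OF smooth]
    by (auto intro!: continuous_intros smooth_on_continuous_frame_volume)
  have inj: "inj (frechet_derivative \<Phi> (at x)) \<longleftrightarrow> v x \<noteq> 0" for x
    using sp[of x] inj_iff_frame_volume[of "frechet_derivative \<Phi> (at x)"]
    by (auto simp: special_map_def v_def complex_eq_iff)
  have "{x. inj (frechet_derivative \<Phi> (at x))} = v -` (- {0})" by (auto simp: inj)
  then have "open {x. inj (frechet_derivative \<Phi> (at x))}"
    using open_vimage[OF _ cont, of "- {0}"] by (simp add: open_Compl)
  moreover have "continuous_on {x. inj (frechet_derivative \<Phi> (at x))} (\<lambda>x. sgn (v x))"
    by (intro continuous_on_sgn cont) (simp add: inj)
  ultimately show ?thesis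
    unfolding special_lagrangian_immersion_def immersion_on_def
    using smooth_on_subset[OF smooth] calibrated_oriented_frames[OF sp]
    by (intro conjI exI[of _ "\<lambda>x. sgn (v x)"]) (auto simp: v_def[symmetric] inj sgn_if)
qed

section \<open>Smoothness of maps generated by the cross product\<close>

text \<open>A family of maps closed under directional derivatives consists of smooth maps. This handles all orders of
  differentiability at once.\<close>

lemma smooth_on_UNIV_coinduct:
  assumes "f \<in> S"
    and "\<And>f. f \<in> S \<Longrightarrow> \<exists>f'. (\<forall>x. (f has_derivative f' x) (at x)) \<and> (\<forall>v. (\<lambda>x. f' x v) \<in> S)"
  shows "smooth_on f UNIV"
proof -
  have "Ck_on k f UNIV" if "f \<in> S" for k f
    using that
  proof (induction k arbitrary: f)
    case 0
    then show ?case
      by (auto intro!: continuous_at_imp_continuous_on) (meson assms(2) has_derivative_continuous)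
  next
    case (Suc k)
    obtain f' where f': "\<And>x. (f has_derivative f' x) (at x)" "\<And>v. (\<lambda>x. f' x v) \<in> S"
      using assms(2)[OF Suc.prems] by blast
    have "frechet_derivative f (at x) = f' x" for x
      using frechet_derivative_at[OF f'(1)] by simp
    then show ?case
      using Suc.IH[OF f'(2)] f'(1) by (auto simp: differentiable_def)
  qed
  then show ?thesis using assms(1) by (simp add: smooth_on_def)
qed

text \<open>The maps obtained from curves in \<open>Z\<close>, read as functions of the time coordinate \<open>x $ 3\<close>, by operations that the
  evolution equations and the product rule do not leave.\<close>

inductive_set ccross_algebra :: "(real \<Rightarrow> complex^3) set \<Rightarrow> (real^3 \<Rightarrow> complex^3) set" for Z where
  gen: "z \<in> Z \<Longrightarrow> (\<lambda>x. z (x $ 3)) \<in> ccross_algebra Z"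
| add: "f \<in> ccross_algebra Z \<Longrightarrow> g \<in> ccross_algebra Z \<Longrightarrow> (\<lambda>x. f x + g x) \<in> ccross_algebra Z"
| scale: "f \<in> ccross_algebra Z \<Longrightarrow> (\<lambda>x. c *\<^sub>R f x) \<in> ccross_algebra Z"
| coordinate: "f \<in> ccross_algebra Z \<Longrightarrow> (\<lambda>x. (x $ i) *\<^sub>R f x) \<in> ccross_algebra Z"
| cross: "f \<in> ccross_algebra Z \<Longrightarrow> g \<in> ccross_algebra Z \<Longrightarrow> (\<lambda>x. ccross (f x) (g x)) \<in> ccross_algebra Z"

lemma has_derivative_third_coordinate:
  fixes z :: "real \<Rightarrow> 'a::real_normed_vector"
  assumes "(z has_vector_derivative z') (at (x $ 3))"
  shows "((\<lambda>x::real^3. z (x $ 3)) has_derivative (\<lambda>h. (h $ 3) *\<^sub>R z')) (at x)"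
  using has_derivative_compose[OF bounded_linear.has_derivative[OF bounded_linear_vec_nth has_derivative_ident]
      assms[unfolded has_vector_derivative_def]] .

text \<open>If the velocities of the curves in \<open>Z\<close> are again expressions in these curves, then by the product rule the generated
  family is closed under directional derivatives.\<close>

lemma ccross_algebra_smooth:
  assumes Z: "\<And>z. z \<in> Z \<Longrightarrow> \<exists>z'. (\<forall>t. (z has_vector_derivative z' t) (at t)) \<and>
      (\<lambda>x. z' (x $ 3)) \<in> ccross_algebra Z"
    and "f \<in> ccross_algebra Z"
  shows "smooth_on f UNIV"
  using assms(2)
proof (rule smooth_on_UNIV_coinduct)
  fix f assume "f \<in> ccross_algebra Z"
  then show "\<exists>f'. (\<forall>x. (f has_derivative f' x) (at x)) \<and> (\<forall>v. (\<lambda>x. f' x v) \<in> ccross_algebra Z)"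
  proof induction
    case (gen z)
    then obtain z' where z': "\<And>t. (z has_vector_derivative z' t) (at t)"
      "(\<lambda>x. z' (x $ 3)) \<in> ccross_algebra Z" using Z by blast
    then show ?case
      by (intro exI[of _ "\<lambda>x h. (h $ 3) *\<^sub>R z' (x $ 3)"])
        (auto intro: has_derivative_third_coordinate ccross_algebra.scale)
  next
    case (add f g)
    then obtain f' g' where
      "\<And>x. (f has_derivative f' x) (at x)" "\<And>v. (\<lambda>x. f' x v) \<in> ccross_algebra Z"
      "\<And>x. (g has_derivative g' x) (at x)" "\<And>v. (\<lambda>x. g' x v) \<in> ccross_algebra Z" by blast
    then show ?case
      by (intro exI[of _ "\<lambda>x h. f' x h + g' x h"]) (auto intro: has_derivative_add ccross_algebra.add)
  next
    case (scale f c)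
    then obtain f' where
      "\<And>x. (f has_derivative f' x) (at x)" "\<And>v. (\<lambda>x. f' x v) \<in> ccross_algebra Z" by blast
    then show ?case
      by (intro exI[of _ "\<lambda>x h. c *\<^sub>R f' x h"])
        (auto intro: has_derivative_scaleR_right ccross_algebra.scale)
  next
    case (coordinate f i)
    then obtain f' where
      f': "\<And>x. (f has_derivative f' x) (at x)" "\<And>v. (\<lambda>x. f' x v) \<in> ccross_algebra Z" by blast
    have "((\<lambda>x. (x $ i) *\<^sub>R f x) has_derivative (\<lambda>h. (x $ i) *\<^sub>R f' x h + (h $ i) *\<^sub>R f x)) (at x)" for x
      by (intro has_derivative_scaleR f' bounded_linear.has_derivative[OF bounded_linear_vec_nth]
          has_derivative_ident)
    moreover have "(\<lambda>x. (x $ i) *\<^sub>R f' x v + (v $ i) *\<^sub>R f x) \<in> ccross_algebra Z" for v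
      by (intro ccross_algebra.add ccross_algebra.coordinate ccross_algebra.scale f' coordinate.hyps)
    ultimately show ?case
      by (intro exI[of _ "\<lambda>x h. (x $ i) *\<^sub>R f' x h + (h $ i) *\<^sub>R f x"]) blast
  next
    case (cross f g)
    then obtain f' g' where fg:
      "\<And>x. (f has_derivative f' x) (at x)" "\<And>v. (\<lambda>x. f' x v) \<in> ccross_algebra Z"
      "\<And>x. (g has_derivative g' x) (at x)" "\<And>v. (\<lambda>x. g' x v) \<in> ccross_algebra Z" by blast
    have "((\<lambda>x. ccross (f x) (g x)) has_derivative
        (\<lambda>h. ccross (f x) (g' x h) + ccross (f' x h) (g x))) (at x)" for x
      by (rule ccross.FDERIV[OF fg(1) fg(3)])
    moreover have "(\<lambda>x. ccross (f x) (g' x v) + ccross (f' x v) (g x)) \<in> ccross_algebra Z" for v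
      by (intro ccross_algebra.add ccross_algebra.cross fg cross.hyps)
    ultimately show ?case
      by (intro exI[of _ "\<lambda>x h. ccross (f x) (g' x h) + ccross (f' x h) (g x)"]) blast
  qed
qed

text \<open>With \<open>a, b, c, d, e\<close> standing for \<open>z\<^sub>1, \<dots>, z\<^sub>5\<close>, the arguments on the left are the two \<open>y\<close>-derivatives of \<open>\<Phi>\<close>; the
  coefficients on the right are the right-hand sides of the evolution equations.\<close>

lemma ccross_quadratic:
  "ccross (y1 *\<^sub>R (a + b) + y2 *\<^sub>R c + d) (y2 *\<^sub>R (a - b) + y1 *\<^sub>R c + e) =
     (y1\<^sup>2 + y2\<^sup>2) *\<^sub>R ccross b c + (y1\<^sup>2 - y2\<^sup>2) *\<^sub>R ccross a c - (2 * (y1 * y2)) *\<^sub>R ccross a b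
     + y1 *\<^sub>R (ccross a e + ccross b e - ccross c d)
     + y2 *\<^sub>R (- ccross a d + ccross b d + ccross c e) + ccross d e"
  by (simp add: vec_eq_iff forall_3 scaleR_conv_of_real[where 'a=complex] power2_eq_square field_simps)

text \<open>Here \<open>u\<close> and \<open>v\<close> are the \<open>y\<close>-derivatives of \<open>\<Phi>\<close>, and \<open>a\<close>, \<open>c\<close>, \<open>d\<close> the second derivatives
  \<open>\<partial>u/\<partial>y\<^sub>1\<close>, \<open>\<partial>u/\<partial>y\<^sub>2 = \<partial>v/\<partial>y\<^sub>1\<close>, \<open>\<partial>v/\<partial>y\<^sub>2\<close>. Differentiating \<open>\<partial>\<Phi>/\<partial>t = u \<times> v\<close> by \<open>y\<^sub>1\<close> and by \<open>y\<^sub>2\<close> gives the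
  velocities of \<open>u\<close> and \<open>v\<close>, so the sum is the time derivative of \<open>\<omega>(u,v)\<close>. The terms with
  a repeated argument vanish and the two terms in \<open>u, v, c\<close> cancel because the same \<open>c\<close> occurs in both velocities.\<close>

lemma kahler_form_flow:
  "kahler_form u (ccross c v + ccross u d) + kahler_form (ccross a v + ccross u c) v = 0"
  using kahler_form_ccross_cycle[of v u c] kahler_form_ccross_cycle[of u c v]
    kahler_form_commute[of "ccross a v" v] kahler_form_commute[of "ccross u c" v]
    kahler_form_ccross_self
  by (simp add: kahler.add_left kahler.add_right)

section \<open>The evolution equations\<close>

locale quadratic_evolution =
  fixes z1 z2 z3 z4 z5 z6 :: "real \<Rightarrow> complex^3"
  assumes init: "kahler_form (z2 0) (z3 0) = 0"
      "kahler_form (z1 0) (z3 0) = 0"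
      "kahler_form (z1 0) (z2 0) = 0"
      "kahler_form (z1 0) (z5 0) + kahler_form (z2 0) (z5 0) - kahler_form (z3 0) (z4 0) = 0"
      "- kahler_form (z1 0) (z4 0) + kahler_form (z2 0) (z4 0) + kahler_form (z3 0) (z5 0) = 0"
      "kahler_form (z4 0) (z5 0) = 0"
    and ode:
      "\<And>t. (z1 has_vector_derivative 2 *\<^sub>R ccross (z2 t) (z3 t)) (at t)"
      "\<And>t. (z2 has_vector_derivative 2 *\<^sub>R ccross (z1 t) (z3 t)) (at t)"
      "\<And>t. (z3 has_vector_derivative (-2) *\<^sub>R ccross (z1 t) (z2 t)) (at t)"
      "\<And>t. (z4 has_vector_derivative
             ccross (z1 t) (z5 t) + ccross (z2 t) (z5 t) - ccross (z3 t) (z4 t)) (at t)"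
      "\<And>t. (z5 has_vector_derivative
             - ccross (z1 t) (z4 t) + ccross (z2 t) (z4 t) + ccross (z3 t) (z5 t)) (at t)"
      "\<And>t. (z6 has_vector_derivative ccross (z4 t) (z5 t)) (at t)"
begin

definition partial_y1 :: "real \<Rightarrow> real \<Rightarrow> real \<Rightarrow> complex^3" where
  "partial_y1 y1 y2 t = y1 *\<^sub>R (z1 t + z2 t) + y2 *\<^sub>R z3 t + z4 t"

definition partial_y2 :: "real \<Rightarrow> real \<Rightarrow> real \<Rightarrow> complex^3" where
  "partial_y2 y1 y2 t = y2 *\<^sub>R (z1 t - z2 t) + y1 *\<^sub>R z3 t + z5 t"

definition sweep :: "real^3 \<Rightarrow> complex^3" where
  "sweep x = (((x $ 1)\<^sup>2 + (x $ 2)\<^sup>2) / 2) *\<^sub>R z1 (x $ 3) + (((x $ 1)\<^sup>2 - (x $ 2)\<^sup>2) / 2) *\<^sub>R z2 (x $ 3)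
     + (x $ 1 * x $ 2) *\<^sub>R z3 (x $ 3) + (x $ 1) *\<^sub>R z4 (x $ 3) + (x $ 2) *\<^sub>R z5 (x $ 3) + z6 (x $ 3)"

text \<open>The right-hand side is the \<open>y\<^sub>1\<close>-derivative of \<open>u \<times> v\<close>, in the form to which \<open>kahler_form_flow\<close> applies.
  The companion for the other partial derivative uses the \<open>y\<^sub>2\<close>-derivative of the same product.\<close>

lemma partial_y1_derivative:
  "(partial_y1 y1 y2 has_vector_derivative ccross (z1 t + z2 t) (partial_y2 y1 y2 t) + ccross (partial_y1 y1 y2 t) (z3 t)) (at t)"
proof -
  have "(partial_y1 y1 y2 has_vector_derivative y1 *\<^sub>R (2 *\<^sub>R ccross (z2 t) (z3 t) + 2 *\<^sub>R ccross (z1 t) (z3 t))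
      + y2 *\<^sub>R ((-2) *\<^sub>R ccross (z1 t) (z2 t))
      + (ccross (z1 t) (z5 t) + ccross (z2 t) (z5 t) - ccross (z3 t) (z4 t))) (at t)"
    unfolding partial_y1_def[abs_def]
    by (intro has_vector_derivative_add bounded_linear.has_vector_derivative[OF bounded_linear_scaleR_right] ode)
  also have "y1 *\<^sub>R (2 *\<^sub>R ccross (z2 t) (z3 t) + 2 *\<^sub>R ccross (z1 t) (z3 t)) + y2 *\<^sub>R ((-2) *\<^sub>R ccross (z1 t) (z2 t))
      + (ccross (z1 t) (z5 t) + ccross (z2 t) (z5 t) - ccross (z3 t) (z4 t))
    = ccross (z1 t + z2 t) (partial_y2 y1 y2 t) + ccross (partial_y1 y1 y2 t) (z3 t)"
    by (simp add: partial_y1_def partial_y2_def vec_eq_iff forall_3 scaleR_conv_of_real[where 'a=complex] field_simps)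
  finally show ?thesis .
qed

lemma partial_y2_derivative:
  "(partial_y2 y1 y2 has_vector_derivative ccross (z3 t) (partial_y2 y1 y2 t) + ccross (partial_y1 y1 y2 t) (z1 t - z2 t)) (at t)"
proof -
  have "(partial_y2 y1 y2 has_vector_derivative y2 *\<^sub>R (2 *\<^sub>R ccross (z2 t) (z3 t) - 2 *\<^sub>R ccross (z1 t) (z3 t))
      + y1 *\<^sub>R ((-2) *\<^sub>R ccross (z1 t) (z2 t))
      + (- ccross (z1 t) (z4 t) + ccross (z2 t) (z4 t) + ccross (z3 t) (z5 t))) (at t)"
    unfolding partial_y2_def[abs_def]
    by (intro has_vector_derivative_add has_vector_derivative_diff
        bounded_linear.has_vector_derivative[OF bounded_linear_scaleR_right] ode)
  also have "y2 *\<^sub>R (2 *\<^sub>R ccross (z2 t) (z3 t) - 2 *\<^sub>R ccross (z1 t) (z3 t)) + y1 *\<^sub>R ((-2) *\<^sub>R ccross (z1 t) (z2 t))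
      + (- ccross (z1 t) (z4 t) + ccross (z2 t) (z4 t) + ccross (z3 t) (z5 t))
    = ccross (z3 t) (partial_y2 y1 y2 t) + ccross (partial_y1 y1 y2 t) (z1 t - z2 t)"
    by (simp add: partial_y1_def partial_y2_def vec_eq_iff forall_3 scaleR_conv_of_real[where 'a=complex] field_simps)
  finally show ?thesis .
qed

text \<open>The form is conserved in time, and its initial value is a quadratic polynomial in \<open>y\<close> whose coefficients are
  the six quantities assumed to vanish at time zero.\<close>

lemma kahler_form_partials: "kahler_form (partial_y1 y1 y2 t) (partial_y2 y1 y2 t) = 0"
proof -
  have "((\<lambda>t. kahler_form (partial_y1 y1 y2 t) (partial_y2 y1 y2 t)) has_vector_derivative 0) (at t)" for t
    using kahler.has_vector_derivative[OF partial_y1_derivative[of y1 y2 t] partial_y2_derivative[of y1 y2 t]] 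
    by (simp only: kahler_form_flow)
  then obtain c where "kahler_form (partial_y1 y1 y2 t) (partial_y2 y1 y2 t) = c" for t
    using has_derivative_zero_constant[of UNIV "\<lambda>t. kahler_form (partial_y1 y1 y2 t) (partial_y2 y1 y2 t)"]
    by (auto simp: has_vector_derivative_def)
  then have "kahler_form (partial_y1 y1 y2 t) (partial_y2 y1 y2 t) = kahler_form (partial_y1 y1 y2 0) (partial_y2 y1 y2 0)"
    by simp
  also have "\<dots> = 0"
  proof -
    have "kahler_form (partial_y1 y1 y2 0) (partial_y2 y1 y2 0) =
        - (2 * y1 * y2) * kahler_form (z1 0) (z2 0)
        + (y1\<^sup>2 - y2\<^sup>2) * kahler_form (z1 0) (z3 0) + (y1\<^sup>2 + y2\<^sup>2) * kahler_form (z2 0) (z3 0)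
        + y1 * (kahler_form (z1 0) (z5 0) + kahler_form (z2 0) (z5 0) - kahler_form (z3 0) (z4 0))
        + y2 * (- kahler_form (z1 0) (z4 0) + kahler_form (z2 0) (z4 0) + kahler_form (z3 0) (z5 0))
        + kahler_form (z4 0) (z5 0)"
      by (simp add: partial_y1_def partial_y2_def kahler.add_left kahler.add_right kahler.diff_right kahler.scaleR_left
          kahler.scaleR_right kahler_form_commute[of "z2 0" "z1 0"] kahler_form_commute[of "z3 0" "z1 0"]
          kahler_form_commute[of "z3 0" "z2 0"] kahler_form_commute[of "z4 0" "z1 0"]
          kahler_form_commute[of "z4 0" "z2 0"] kahler_form_commute[of "z4 0" "z3 0"]
          power2_eq_square algebra_simps)
    then show ?thesis by (simp only: init)
  qed
  finally show ?thesis .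
qed

definition sweep_derivative :: "real^3 \<Rightarrow> real^3 \<Rightarrow> complex^3" where
  "sweep_derivative x h = (h $ 1) *\<^sub>R partial_y1 (x $ 1) (x $ 2) (x $ 3) + (h $ 2) *\<^sub>R partial_y2 (x $ 1) (x $ 2) (x $ 3)
     + (h $ 3) *\<^sub>R ccross (partial_y1 (x $ 1) (x $ 2) (x $ 3)) (partial_y2 (x $ 1) (x $ 2) (x $ 3))"

lemma sweep_has_derivative: "(sweep has_derivative sweep_derivative x) (at x)"
proof -
  have coord: "((\<lambda>x::real^3. x $ i) has_derivative (\<lambda>h. h $ i)) (at x)" for i
    by (intro bounded_linear.has_derivative[OF bounded_linear_vec_nth] has_derivative_ident)
  have ccross_partials: "ccross (partial_y1 y1 y2 t) (partial_y2 y1 y2 t) =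
     (y1\<^sup>2 + y2\<^sup>2) *\<^sub>R ccross (z2 t) (z3 t) + (y1\<^sup>2 - y2\<^sup>2) *\<^sub>R ccross (z1 t) (z3 t)
     - (2 * (y1 * y2)) *\<^sub>R ccross (z1 t) (z2 t)
     + y1 *\<^sub>R (ccross (z1 t) (z5 t) + ccross (z2 t) (z5 t) - ccross (z3 t) (z4 t))
     + y2 *\<^sub>R (- ccross (z1 t) (z4 t) + ccross (z2 t) (z4 t) + ccross (z3 t) (z5 t))
     + ccross (z4 t) (z5 t)" for y1 y2 t
    unfolding partial_y1_def partial_y2_def by (rule ccross_quadratic)
  show ?thesis
    unfolding sweep_def[abs_def] sweep_derivative_def[abs_def] ccross_partials
    by (rule has_derivative_eq_rhs, (rule has_derivative_add has_derivative_scaleR has_derivative_mult has_derivative_diff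
      has_derivative_power bounded_linear.has_derivative[OF bounded_linear_divide] coord
      has_derivative_third_coordinate[OF ode(1)]
      has_derivative_third_coordinate[OF ode(2)] has_derivative_third_coordinate[OF ode(3)]
      has_derivative_third_coordinate[OF ode(4)] has_derivative_third_coordinate[OF ode(5)]
      has_derivative_third_coordinate[OF ode(6)])+)
      (simp add: fun_eq_iff partial_y1_def partial_y2_def algebra_simps power2_eq_square add_divide_distrib diff_divide_distrib)
qed

lemma smooth_sweep: "smooth_on sweep UNIV"
proof (rule ccross_algebra_smooth)
  let ?Z = "{z1, z2, z3, z4, z5, z6}"
  let ?A = "ccross_algebra ?Z"
  have g: "(\<lambda>x. z1 (x $ 3)) \<in> ?A" "(\<lambda>x. z2 (x $ 3)) \<in> ?A" "(\<lambda>x. z3 (x $ 3)) \<in> ?A"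
    "(\<lambda>x. z4 (x $ 3)) \<in> ?A" "(\<lambda>x. z5 (x $ 3)) \<in> ?A" "(\<lambda>x. z6 (x $ 3)) \<in> ?A"
    by (intro ccross_algebra.gen; simp)+
  have minus: "(\<lambda>x. - f x) \<in> ?A" if "f \<in> ?A" for f
    using ccross_algebra.scale[OF that, of "-1"] by simp
  have diff: "(\<lambda>x. f x - g x) \<in> ?A" if "f \<in> ?A" "g \<in> ?A" for f g
    using ccross_algebra.add[OF that(1) minus[OF that(2)]] by simp
  show "\<exists>z'. (\<forall>t. (z has_vector_derivative z' t) (at t)) \<and> (\<lambda>x. z' (x $ 3)) \<in> ?A" if "z \<in> ?Z" for z
  proof -
    define velocity_in where "velocity_in z \<longleftrightarrow>
        (\<exists>z'. (\<forall>t. (z has_vector_derivative z' t) (at t)) \<and> (\<lambda>x. z' (x $ 3)) \<in> ?A)" for z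
    have velocity_inI: "velocity_in z"
      if "\<And>t. (z has_vector_derivative z' t) (at t)" "(\<lambda>x. z' (x $ 3)) \<in> ?A" for z z'
      using that by (auto simp: velocity_in_def)
    note closed = ccross_algebra.add ccross_algebra.scale ccross_algebra.cross diff minus g
    have "velocity_in z1" "velocity_in z2" "velocity_in z3" "velocity_in z4" "velocity_in z5" "velocity_in z6"
      by (rule velocity_inI, rule ode, intro closed)+
    then show ?thesis
      using that unfolding velocity_in_def by blast
  qed
  have "sweep = (\<lambda>x. (1/2) *\<^sub>R ((x $ 1) *\<^sub>R (x $ 1) *\<^sub>R z1 (x $ 3) + (x $ 2) *\<^sub>R (x $ 2) *\<^sub>R z1 (x $ 3))
      + (1/2) *\<^sub>R ((x $ 1) *\<^sub>R (x $ 1) *\<^sub>R z2 (x $ 3) - (x $ 2) *\<^sub>R (x $ 2) *\<^sub>R z2 (x $ 3))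
      + (x $ 1) *\<^sub>R (x $ 2) *\<^sub>R z3 (x $ 3) + (x $ 1) *\<^sub>R z4 (x $ 3) + (x $ 2) *\<^sub>R z5 (x $ 3) + z6 (x $ 3))"
    by (simp add: fun_eq_iff sweep_def power2_eq_square algebra_simps add_divide_distrib diff_divide_distrib)
  then show "sweep \<in> ?A"
    by (simp only:) (intro ccross_algebra.add ccross_algebra.scale ccross_algebra.coordinate diff g)
qed

text \<open>Two of the three pairings of the partial derivatives vanish because \<open>u \<times> v\<close> is
  orthogonal to \<open>u\<close> and \<open>v\<close>; the third is the conserved quantity.\<close>

lemma special_map_sweep_derivative: "special_map (sweep_derivative x)"
proof -
  let ?u = "partial_y1 (x $ 1) (x $ 2) (x $ 3)" and ?v = "partial_y2 (x $ 1) (x $ 2) (x $ 3)"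
  have "linear (sweep_derivative x)" using sweep_has_derivative by (rule has_derivative_linear)
  moreover have "isotropic_map (sweep_derivative x)"
    by (simp add: isotropic_map_def sweep_derivative_def kahler.add_left kahler.add_right kahler.scaleR_left
      kahler.scaleR_right kahler_form_partials kahler_form_ccross_self kahler_form_commute[of "ccross _ _"]
      kahler_form_commute[of ?v ?u])
  moreover have "frame_volume (sweep_derivative x) = hol_volume_form ?u ?v (ccross ?u ?v)"
    by (simp add: frame_volume_def sweep_derivative_def axis_def)
  ultimately show ?thesis
    by (simp add: special_map_def Im_hol_volume_form_ccross)
qed

end

theorem theorem5p1:
  fixes z1 z2 z3 z4 z5 z6 :: "real \<Rightarrow> complex^3"
    and \<Phi> :: "real^3 \<Rightarrow> complex^3" and N :: "(complex^3) set"
  assumes "kahler_form (z2 0) (z3 0) = 0"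
    and "kahler_form (z1 0) (z3 0) = 0"
    and "kahler_form (z1 0) (z2 0) = 0"
    and "kahler_form (z1 0) (z5 0) + kahler_form (z2 0) (z5 0) - kahler_form (z3 0) (z4 0) = 0"
    and "- kahler_form (z1 0) (z4 0) + kahler_form (z2 0) (z4 0) + kahler_form (z3 0) (z5 0) = 0"
    and "kahler_form (z4 0) (z5 0) = 0"
    and "\<And>t. (z1 has_vector_derivative 2 *\<^sub>R ccross (z2 t) (z3 t)) (at t)"
    and "\<And>t. (z2 has_vector_derivative 2 *\<^sub>R ccross (z1 t) (z3 t)) (at t)"
    and "\<And>t. (z3 has_vector_derivative (-2) *\<^sub>R ccross (z1 t) (z2 t)) (at t)"
    and "\<And>t. (z4 has_vector_derivative
           ccross (z1 t) (z5 t) + ccross (z2 t) (z5 t) - ccross (z3 t) (z4 t)) (at t)"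
    and "\<And>t. (z5 has_vector_derivative
           - ccross (z1 t) (z4 t) + ccross (z2 t) (z4 t) + ccross (z3 t) (z5 t)) (at t)"
    and "\<And>t. (z6 has_vector_derivative ccross (z4 t) (z5 t)) (at t)"
    and \<Phi>: "\<And>y1 y2 t. \<Phi> (vector [y1, y2, t]) =
           ((y1\<^sup>2 + y2\<^sup>2) / 2) *\<^sub>R z1 t + ((y1\<^sup>2 - y2\<^sup>2) / 2) *\<^sub>R z2 t + (y1 * y2) *\<^sub>R z3 t
           + y1 *\<^sub>R z4 t + y2 *\<^sub>R z5 t + z6 t"
    and N: "N = {\<Phi> (vector [y1, y2, t]) | y1 y2 t. True}"
  shows "special_lagrangian_immersion \<Phi>
           {x. \<Phi> differentiable (at x) \<and> inj (frechet_derivative \<Phi> (at x))}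
       \<and> (\<forall>U. open U \<and> submanifold3 (N \<inter> U) \<longrightarrow> special_lagrangian (N \<inter> U))"
proof -
  interpret quadratic_evolution z1 z2 z3 z4 z5 z6
    by unfold_locales (fact assms)+
  have "\<Phi> x = sweep x" for x
  proof -
    have "x = vector [x $ 1, x $ 2, x $ 3]"
      by (simp add: vec_eq_iff forall_3)
    then show ?thesis
      using \<Phi>[of "x $ 1" "x $ 2" "x $ 3"] by (simp add: sweep_def)
  qed
  then have \<Phi>_eq: "\<Phi> = sweep" ..
  have N_eq: "N = range sweep"
  proof -
    have "sweep x \<in> N" for x
    proof -
      have "x = vector [x $ 1, x $ 2, x $ 3]"
        by (simp add: vec_eq_iff forall_3)
      then have "sweep x = sweep (vector [x $ 1, x $ 2, x $ 3])"
        by (rule arg_cong)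
      then show ?thesis unfolding N \<Phi>_eq by blast
    qed
    then show ?thesis unfolding N \<Phi>_eq by blast
  qed
  have frechet: "frechet_derivative sweep (at x) = sweep_derivative x" for x
    using frechet_derivative_at[OF sweep_has_derivative] by simp
  have "special_lagrangian_immersion sweep {x. inj (frechet_derivative sweep (at x))}"
    by (intro special_lagrangian_immersionI smooth_sweep) (simp add: frechet special_map_sweep_derivative)
  moreover have "sweep differentiable (at x)" for x
    using sweep_has_derivative by (rule differentiableI)
  moreover have "special_lagrangian (N \<inter> U)" if "open U" "submanifold3 (N \<inter> U)" for U
    using that(2) special_map_image_tangent[OF sweep_has_derivative special_map_sweep_derivative that(1)]
    by (intro special_lagrangianI) (auto simp: N_eq)
  ultimately show ?thesis
    by (simp add: \<Phi>_eq)
qed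

end
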